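(* Let $V=[n]$ be a finite set, $k\ge 1$ an integer and $\varepsilon>0$. Let $f:(k+1)^V\to\mathbb{R}$ be a monotone $k$-submodular function with $f(\mathbf{0})=0$, and let $F:(k+1)^V\to\mathbb{R}_{\ge 0}$ with $F(\mathbf{0})=0$ satisfy $(1-\varepsilon)\Delta_{u,i}f(\mathbf{x})\le \Delta_{u,i}F(\mathbf{x})\le (1+\varepsilon)\Delta_{u,i}f(\mathbf{x})$ for all $\mathbf{x}\in(k+1)^V$, all $u\in V\setminus \mathrm{supp}(\mathbf{x})$ and all $i\in[k]$ (i.e. $F$ is $\varepsilon$-approximately diminishing returns). Then $(1-\varepsilon)f(\mathbf{x})\le F(\mathbf{x})\le(1+\varepsilon)f(\mathbf{x})$ for all $\mathbf{x}\in(k+1)^V$; in particular $F$ is $\varepsilon$-approximately $k$-submodular (with the same witness $f$).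
   Context: $(k+1)^V$ denotes the set of $k$-tuples $\mathbf{x}=(X_1,\dots,X_k)$ of pairwise disjoint subsets of $V$; $\mathbf{0}=(\emptyset,\dots,\emptyset)$; $\mathrm{supp}(\mathbf{x})=\bigcup_{i}X_i$; $\mathbf{x}\preceq\mathbf{y}$ means $X_i\subseteq Y_i$ for all $i$. For $g:(k+1)^V\to\mathbb{R}$, $u\notin\mathrm{supp}(\mathbf{x})$, $i\in[k]$: $\Delta_{u,i}g(\mathbf{x})=g(X_1,\dots,X_{i-1},X_i\cup\{u\},X_{i+1},\dots,X_k)-g(\mathbf{x})$. $f$ is $k$-submodular if (a) $\Delta_{u,i}f(\mathbf{x})\ge\Delta_{u,i}f(\mathbf{y})$ whenever $\mathbf{x}\preceq\mathbf{y}$, $u\notin\mathrm{supp}(\mathbf{y})$, $i\in[k]$, and (b) $\Delta_{u,i}f(\mathbf{x})+\Delta_{u,j}f(\mathbf{x})\ge 0$ for all $\mathbf{x}$, $u\notin\mathrm{supp}(\mathbf{x})$, $i\ne j$. $f$ is monotone if $\mathbf{x}\preceq\mathbf{y}$ implies $f(\mathbf{x})\le f(\mathbf{y})$. A function $F:(k+1)^V\to\mathbb{R}_{\ge0}$ is $\varepsilon$-approximately $k$-submodular ($\varepsilon$-AS) if there is a monotone $k$-submodular $f$ with $(1-\varepsilon)f(\mathbf{x})\le F(\mathbf{x})\le(1+\varepsilon)f(\mathbf{x})$ for all $\mathbf{x}$; it is $\varepsilon$-approximately diminishing returns ($\varepsilon$-ADR) if there is a monotone $k$-submodular $f$ satisfying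 the marginal-gain inequality in the claim. Functions are normalized so that $F(\mathbf{0})=f(\mathbf{0})=0$. *)

theory Defs
  imports Complex_Main "HOL-Library.FuncSet" "HOL-Library.Disjoint_Sets"
begin

text \<open>A \<open>k\<close>-tuple of subsets of \<open>V\<close> is a function on \<open>{1..k}\<close>, extensional in the sense of
  \<open>PiE\<close>, so that each tuple has exactly one representative.\<close>

definition ktuples :: "nat \<Rightarrow> 'a set \<Rightarrow> (nat \<Rightarrow> 'a set) set" where
  "ktuples k V = {x \<in> {1..k} \<rightarrow>\<^sub>E Pow V. disjoint_family_on x {1..k}}"

definition zero_tuple :: "nat \<Rightarrow> nat \<Rightarrow> 'a set" where
  "zero_tuple k = (\<lambda>i\<in>{1..k}. {})"

definition supp :: "nat \<Rightarrow> (nat \<Rightarrow> 'a set) \<Rightarrow> 'a set" where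
  "supp k x = (\<Union>i\<in>{1..k}. x i)"

definition tuple_le :: "nat \<Rightarrow> (nat \<Rightarrow> 'a set) \<Rightarrow> (nat \<Rightarrow> 'a set) \<Rightarrow> bool" where
  "tuple_le k x y \<longleftrightarrow> (\<forall>i\<in>{1..k}. x i \<subseteq> y i)"

definition marginal :: "((nat \<Rightarrow> 'a set) \<Rightarrow> real) \<Rightarrow> 'a \<Rightarrow> nat \<Rightarrow> (nat \<Rightarrow> 'a set) \<Rightarrow> real" where
  "marginal g u i x = g (x(i := x i \<union> {u})) - g x"

definition k_submodular :: "nat \<Rightarrow> 'a set \<Rightarrow> ((nat \<Rightarrow> 'a set) \<Rightarrow> real) \<Rightarrow> bool" where
  "k_submodular k V f \<longleftrightarrow>
     (\<forall>x\<in>ktuples k V. \<forall>y\<in>ktuples k V. \<forall>u\<in>V - supp k y. \<forall>i\<in>{1..k}.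
        tuple_le k x y \<longrightarrow> marginal f u i x \<ge> marginal f u i y) \<and>
     (\<forall>x\<in>ktuples k V. \<forall>u\<in>V - supp k x. \<forall>i\<in>{1..k}. \<forall>j\<in>{1..k}.
        i \<noteq> j \<longrightarrow> marginal f u i x + marginal f u j x \<ge> 0)"

definition k_monotone :: "nat \<Rightarrow> 'a set \<Rightarrow> ((nat \<Rightarrow> 'a set) \<Rightarrow> real) \<Rightarrow> bool" where
  "k_monotone k V f \<longleftrightarrow>
     (\<forall>x\<in>ktuples k V. \<forall>y\<in>ktuples k V. tuple_le k x y \<longrightarrow> f x \<le> f y)"

definition AS_witness ::
  "real \<Rightarrow> nat \<Rightarrow> 'a set \<Rightarrow> ((nat \<Rightarrow> 'a set) \<Rightarrow> real) \<Rightarrow> ((nat \<Rightarrow> 'a set) \<Rightarrow> real) \<Rightarrow> bool" where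
  "AS_witness \<epsilon> k V f F \<longleftrightarrow>
     k_monotone k V f \<and> k_submodular k V f \<and> f (zero_tuple k) = 0 \<and>
     (\<forall>x\<in>ktuples k V. (1 - \<epsilon>) * f x \<le> F x \<and> F x \<le> (1 + \<epsilon>) * f x)"

text \<open>Nonnegativity is the codomain of \<open>F\<close>; both \<open>F\<close> and its witness are normalized to vanish
  at the zero tuple.\<close>

definition approx_k_submodular ::
  "real \<Rightarrow> nat \<Rightarrow> 'a set \<Rightarrow> ((nat \<Rightarrow> 'a set) \<Rightarrow> real) \<Rightarrow> bool" where
  "approx_k_submodular \<epsilon> k V F \<longleftrightarrow>
     (\<forall>x\<in>ktuples k V. F x \<ge> 0) \<and> F (zero_tuple k) = 0 \<and> (\<exists>f. AS_witness \<epsilon> k V f F)"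

lemma zero_tuple_in_ktuples: "zero_tuple k \<in> ktuples k V"
  by (auto simp: ktuples_def zero_tuple_def disjoint_family_on_def)

lemma fun_upd_in_ktuples:
  assumes "x \<in> ktuples k V" "u \<in> V - supp k x" "i \<in> {1..k}"
  shows "x(i := x i \<union> {u}) \<in> ktuples k V"
  using assms by (auto simp: ktuples_def supp_def disjoint_family_on_def PiE_iff extensional_def)

end

(* F and f agree at the zero tuple, and every tuple is built from it by inserting one element
   at a time; the marginal-gain inequalities telescope along such a chain. *)
theory Submission
  imports Defs
begin

text \<open>Each of the two bounds compares two functions that both vanish at the zero tuple, and
  the hypothesis compares their marginals, since a marginal is linear in its function. So both
  bounds are instances of one comparison principle, \<open>le_if_marginal_le\<close>, used for
  \<open>(1 - \<epsilon>) * f\<close> against \<open>F\<close> and for \<open>F\<close> against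
  \<open>(1 + \<epsilon>) * f\<close>. The principle is proved by \<open>ktuples_induct\<close>,
  which reaches every tuple over a finite \<open>V\<close> by legal insertions.\<close>

lemma supp_subset: "x \<in> ktuples k V \<Longrightarrow> supp k x \<subseteq> V"
  by (auto simp: ktuples_def supp_def PiE_iff)

lemma supp_eq_empty_iff:
  assumes "x \<in> ktuples k V"
  shows "supp k x = {} \<longleftrightarrow> x = zero_tuple k"
  using assms
  by (auto simp: ktuples_def supp_def zero_tuple_def PiE_iff extensional_def fun_eq_iff)

text \<open>Undoes one insertion, so that a tuple with nonempty support is a marginal step above a
  tuple with smaller support.\<close>

lemma remove_element:
  assumes x: "x \<in> ktuples k V" and i: "i \<in> {1..k}" and u: "u \<in> x i"
  defines "y \<equiv> x(i := x i - {u})"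
  shows "y \<in> ktuples k V" "u \<in> V - supp k y" "x = y(i := y i \<union> {u})"
    "supp k y = supp k x - {u}"
proof -
  have disj: "x i \<inter> x j = {}" if "j \<in> {1..k}" "j \<noteq> i" for j
    using x i that by (auto simp: ktuples_def disjoint_family_on_def)
  have "y \<in> {1..k} \<rightarrow>\<^sub>E Pow V"
    using x i by (auto simp: y_def ktuples_def PiE_iff extensional_def)
  moreover have "y j \<subseteq> x j" for j
    by (simp add: y_def)
  then have "disjoint_family_on y {1..k}"
    using x unfolding ktuples_def disjoint_family_on_def by blast
  ultimately show "y \<in> ktuples k V"
    by (simp add: ktuples_def)
  \<comment> \<open>By disjointness \<open>u\<close> lies in no component other than
    \<open>x i\<close>, so deleting it there removes it from the whole support.\<close>
  show supp: "supp k y = supp k x - {u}"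
    using disj i u by (fastforce simp: y_def supp_def split: if_splits)
  have "u \<in> V"
    using x i u by (auto simp: ktuples_def PiE_iff)
  then show "u \<in> V - supp k y"
    using supp by simp
  show "x = y(i := y i \<union> {u})"
    using u by (auto simp: y_def fun_eq_iff)
qed

text \<open>Induction on the size of the support, finite because \<open>V\<close> is. The
  \<open>insert\<close> case supplies exactly the side conditions under which marginals are
  constrained.\<close>

lemma ktuples_induct [consumes 2, case_names zero insert]:
  assumes "finite V" and "x \<in> ktuples k V"
    and zero: "P (zero_tuple k)"
    and insert: "\<And>x u i. x \<in> ktuples k V \<Longrightarrow> u \<in> V - supp k x \<Longrightarrow> i \<in> {1..k} \<Longrightarrow> P x \<Longrightarrow>
      P (x(i := x i \<union> {u}))"
  shows "P x"
  using assms(2)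
proof (induction "card (supp k x)" arbitrary: x rule: less_induct)
  case less
  show ?case
  proof (cases "supp k x = {}")
    case True
    then show ?thesis
      using less.prems zero by (simp add: supp_eq_empty_iff)
  next
    case False
    then obtain u i where i: "i \<in> {1..k}" and u: "u \<in> x i"
      unfolding supp_def by blast
    define y where "y = x(i := x i - {u})"
    note y = remove_element[OF less.prems i u, folded y_def]
    have "finite (supp k x)"
      using supp_subset[OF less.prems] \<open>finite V\<close> by (rule finite_subset)
    moreover have "u \<in> supp k x"
      using i u by (auto simp: supp_def)
    ultimately have "card (supp k y) < card (supp k x)"
      unfolding y(4) by (rule card_Diff1_less)
    then have "P y"
      using less.hyps y(1) by blast
    then have "P (y(i := y i \<union> {u}))"
      using insert y(1,2) i by blast
    then show ?thesis
      using y(3) by simp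
  qed
qed

text \<open>Inserting an element adds the marginal to each function, so the inequality survives
  every insertion.\<close>

lemma le_if_marginal_le:
  assumes "finite V" and "x \<in> ktuples k V"
    and zero: "g (zero_tuple k) \<le> h (zero_tuple k)"
    and marginal: "\<And>x u i. x \<in> ktuples k V \<Longrightarrow> u \<in> V - supp k x \<Longrightarrow> i \<in> {1..k} \<Longrightarrow>
      marginal g u i x \<le> marginal h u i x"
  shows "g x \<le> h x"
  using assms(1,2)
proof (induction rule: ktuples_induct)
  case zero
  show ?case by (fact assms(3))
next
  case (insert x u i)
  then show ?case
    using marginal[OF insert(1-3)] unfolding marginal_def by linarith
qed

lemma marginal_cmult: "marginal (\<lambda>x. c * f x) u i x = c * marginal f u i x"
  by (simp add: marginal_def right_diff_distrib)

theorem theorem1: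
  fixes n k :: nat and V :: "nat set" and \<epsilon> :: real
    and f F :: "(nat \<Rightarrow> nat set) \<Rightarrow> real"
  assumes "V = {1..n}" and "k \<ge> 1" and "\<epsilon> > 0"
    and "k_monotone k V f" and "k_submodular k V f" and "f (zero_tuple k) = 0"
    and "\<And>x. x \<in> ktuples k V \<Longrightarrow> F x \<ge> 0" and "F (zero_tuple k) = 0"
    and "\<And>x u i. x \<in> ktuples k V \<Longrightarrow> u \<in> V - supp k x \<Longrightarrow> i \<in> {1..k} \<Longrightarrow>
           (1 - \<epsilon>) * marginal f u i x \<le> marginal F u i x \<and>
           marginal F u i x \<le> (1 + \<epsilon>) * marginal f u i x"
  shows "(\<forall>x\<in>ktuples k V. (1 - \<epsilon>) * f x \<le> F x \<and> F x \<le> (1 + \<epsilon>) * f x)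
         \<and> AS_witness \<epsilon> k V f F \<and> approx_k_submodular \<epsilon> k V F"
proof -
  have "finite V"
    using assms(1) by simp
  have bounds: "(1 - \<epsilon>) * f x \<le> F x \<and> F x \<le> (1 + \<epsilon>) * f x" if x: "x \<in> ktuples k V" for x
  proof
    \<comment> \<open>The factor passes through the marginal as an identity, so the argument also
      covers negative \<open>1 - \<epsilon>\<close>.\<close>
    show "(1 - \<epsilon>) * f x \<le> F x"
      by (rule le_if_marginal_le[OF \<open>finite V\<close> x, where g = "\<lambda>x. (1 - \<epsilon>) * f x"])
        (use assms(6,8,9) in \<open>auto simp: marginal_cmult\<close>)
    show "F x \<le> (1 + \<epsilon>) * f x"
      by (rule le_if_marginal_le[OF \<open>finite V\<close> x, where h = "\<lambda>x. (1 + \<epsilon>) * f x"])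
        (use assms(6,8,9) in \<open>auto simp: marginal_cmult\<close>)
  qed
  then have "AS_witness \<epsilon> k V f F"
    using assms(4-6) by (simp add: AS_witness_def)
  moreover from this have "approx_k_submodular \<epsilon> k V F"
    using assms(7,8) by (auto simp: approx_k_submodular_def)
  ultimately show ?thesis
    using bounds by blast
qed

end
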